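(* Let $s\ge 2$ and $e_1,\dots,e_s\ge2$ be integers, $v:=\prod_{i=1}^s e_i$, $d:=\gcd(e_1-1,\dots,e_s-1)$, and let $k$ be an integer with $1<k<v$. Let $y_0:=1$ and, for $1\le i\le s$, $y_i:=1+\frac{k-1}{v-1}\left(\left(\prod_{j=1}^i e_j\right)-1\right)$. Assume that $v-1$ divides $(k-1)d$ and that, for each $i\in\{1,\dots,s-1\}$, $y_i$ is an integer dividing $(e_{i+1}-1)\left(\prod_{j=1}^i e_j\right)/d$. Let $\mathscr{P}=\prod_{i=1}^s\mathbb{Z}_{e_i}$, let $G=S_{e_1}\wr\cdots\wr S_{e_s}$ be the stabiliser in $\mathrm{Sym}(\mathscr{P})$ of the chain of partitions $\mathscr{C}_0\prec\cdots\prec\mathscr{C}_s$ of $\mathscr{P}$ described in the context, let $$B=\left\{(\delta_1,\dots,\delta_s)\in\mathscr{P} : 0\le\delta_i\le\frac{y_i}{y_{i-1}}-1\text{ for }1\le i\le s\right\},$$ and let $\mathscr{D}=(\mathscr{P},B^G)$, where $B^G=\{B^g : g\in G\}$. Then: (a) $|B|=k$; and (b) $\mathscr{D}$ is a $G$-flag-transitive, $(G,s)$-chain-imprimitive $2$-$(v,k,\lambda)$ design, with $\lambda=\frac{bk(k-1)}{v(v-1)}$, where $b=\prod_{j=1}^s\binom{e_j}{y_j/y_{j-1}}^{k/y_j}$.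
   Context: $\mathbb{Z}_e=\{0,1,\dots,e-1\}$. For $0\le i\le s$, $\mathscr{C}_i$ is the partition of $\mathscr{P}=\prod_{i=1}^s\mathbb{Z}_{e_i}$ in which two points lie in the same class iff their $j$-th coordinates agree for all $j>i$; so $\mathscr{C}_0$ is the partition into singletons, $\mathscr{C}_s=\{\mathscr{P}\}$, and each $\mathscr{C}_i$-class is a union of $e_i$ $\mathscr{C}_{i-1}$-classes. $S_{e_1}\wr\cdots\wr S_{e_s}$ (iterated wreath product) denotes the group of all permutations of $\mathscr{P}$ leaving invariant each of the partitions $\mathscr{C}_0,\dots,\mathscr{C}_s$. A $2$-$(v,k,\lambda)$ design is a pair $(\mathscr{P},\mathscr{B})$ with $|\mathscr{P}|=v$, $\mathscr{B}$ a nonempty set of $k$-subsets of $\mathscr{P}$ (blocks), such that any two distinct points lie in exactly $\lambda$ blocks. It is $G$-flag-transitive if $G$ is a group of automorphisms transitive on the flags, i.e. pairs $(\delta,B)$ with $\delta\in B\in\mathscr{B}$. It is $(G,s)$-chain-imprimitive if $G$ is a group of automorphisms which is transitive on $\mathscr{P}$ and leaves invariant each partition of the chain $\mathscr{C}_0\prec\cdots\prec\mathscr{C}_s$. *)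

theory Defs
  imports Complex_Main "HOL-Algebra.Bij" "HOL-Library.Disjoint_Sets"
begin

section \<open>Designs and groups of automorphisms\<close>

text \<open>
  Permutations of a point set \<open>P\<close> are the elements of \<open>Bij P\<close>, i.e. bijections of \<open>P\<close> that are
  extensional (\<open>undefined\<close> off \<open>P\<close>), so each permutation is represented exactly once.
  A permutation \<open>g\<close> acts on subsets of \<open>P\<close> by \<open>X \<mapsto> g ` X\<close>, and hence on a set \<open>F\<close> of subsets by
  \<open>F \<mapsto> (`) g ` F\<close>.
\<close>

definition two_design :: "'a set \<Rightarrow> 'a set set \<Rightarrow> nat \<Rightarrow> nat \<Rightarrow> nat \<Rightarrow> bool" where
  "two_design P \<B> v k lam \<longleftrightarrow>
     finite P \<and> card P = v \<and> \<B> \<noteq> {} \<and>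
     (\<forall>X\<in>\<B>. X \<subseteq> P \<and> card X = k) \<and>
     (\<forall>x\<in>P. \<forall>y\<in>P. x \<noteq> y \<longrightarrow> card {X \<in> \<B>. x \<in> X \<and> y \<in> X} = lam)"

definition automorphisms :: "'a set \<Rightarrow> 'a set set \<Rightarrow> ('a \<Rightarrow> 'a) set" where
  "automorphisms P \<B> = {g \<in> Bij P. (`) g ` \<B> = \<B>}"

definition automorphism_group :: "('a \<Rightarrow> 'a) set \<Rightarrow> 'a set \<Rightarrow> 'a set set \<Rightarrow> bool" where
  "automorphism_group G P \<B> \<longleftrightarrow> subgroup G (BijGroup P) \<and> G \<subseteq> automorphisms P \<B>"

definition flags :: "'a set \<Rightarrow> 'a set set \<Rightarrow> ('a \<times> 'a set) set" where
  "flags P \<B> = {(x, X). x \<in> P \<and> X \<in> \<B> \<and> x \<in> X}"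

definition flag_transitive :: "('a \<Rightarrow> 'a) set \<Rightarrow> 'a set \<Rightarrow> 'a set set \<Rightarrow> bool" where
  "flag_transitive G P \<B> \<longleftrightarrow>
     automorphism_group G P \<B> \<and>
     (\<forall>(x, X)\<in>flags P \<B>. \<forall>(y, Y)\<in>flags P \<B>. \<exists>g\<in>G. g x = y \<and> g ` X = Y)"

definition block_orbit :: "('a \<Rightarrow> 'a) set \<Rightarrow> 'a set \<Rightarrow> 'a set set" where
  "block_orbit G X = {g ` X | g. g \<in> G}"


section \<open>Chains of partitions\<close>

definition partition_chain :: "'a set \<Rightarrow> nat \<Rightarrow> (nat \<Rightarrow> 'a set set) \<Rightarrow> bool" where
  "partition_chain P s C \<longleftrightarrow>
     C 0 = {{x} | x. x \<in> P} \<and> C s = {P} \<and>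
     (\<forall>i<s. refines P (C i) (C (Suc i)) \<and> C i \<noteq> C (Suc i))"

definition chain_stabiliser :: "'a set \<Rightarrow> nat \<Rightarrow> (nat \<Rightarrow> 'a set set) \<Rightarrow> ('a \<Rightarrow> 'a) set" where
  "chain_stabiliser P s C = {g \<in> Bij P. \<forall>i\<le>s. (`) g ` C i = C i}"

definition chain_imprimitive ::
  "('a \<Rightarrow> 'a) set \<Rightarrow> nat \<Rightarrow> (nat \<Rightarrow> 'a set set) \<Rightarrow> 'a set \<Rightarrow> 'a set set \<Rightarrow> bool" where
  "chain_imprimitive G s C P \<B> \<longleftrightarrow>
     automorphism_group G P \<B> \<and>
     (\<forall>x\<in>P. \<forall>y\<in>P. \<exists>g\<in>G. g x = y) \<and>
     partition_chain P s C \<and>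
     (\<forall>g\<in>G. \<forall>i\<le>s. (`) g ` C i = C i)"


section \<open>The product set and its chain of partitions\<close>

definition product_points :: "nat \<Rightarrow> (nat \<Rightarrow> nat) \<Rightarrow> (nat \<Rightarrow> nat) set" where
  "product_points s e = (\<Pi>\<^sub>E i\<in>{1..s}. {0..<e i})"

definition product_chain :: "nat \<Rightarrow> (nat \<Rightarrow> nat) \<Rightarrow> nat \<Rightarrow> (nat \<Rightarrow> nat) set set" where
  "product_chain s e i =
     product_points s e //
       {(x, y) \<in> product_points s e \<times> product_points s e. \<forall>j\<in>{i<..s}. x j = y j}"

definition iterated_wreath :: "nat \<Rightarrow> (nat \<Rightarrow> nat) \<Rightarrow> ((nat \<Rightarrow> nat) \<Rightarrow> (nat \<Rightarrow> nat)) set" where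
  "iterated_wreath s e = chain_stabiliser (product_points s e) s (product_chain s e)"

end

theory Submission
  imports Defs
begin

text \<open>
  Put \<open>f\<^sub>i = y\<^sub>i / y\<^sub>i\<^sub>-\<^sub>1\<close>. The orbit of the base block consists of the nonempty sets of points that
  meet every \<open>\<C>\<^sub>i\<close>-class in \<open>0\<close> or \<open>y\<^sub>i\<close> points. Such a set is given by choosing \<open>f\<^sub>s\<close> of the
  \<open>e\<^sub>s\<close> top-level slices and, in each of them, a set of the same kind for \<open>s - 1\<close>; flag-transitivity
  follows by induction on \<open>s\<close>. The same recursion counts the \<open>b\<close> blocks, the
  \<open>b k / v\<close> blocks through a point and the blocks through two points. The last number is independent
  of the pair precisely because \<open>(y\<^sub>i - 1) / (e\<^sub>1 \<cdots> e\<^sub>i - 1)\<close> has the same value \<open>(k - 1) / (v - 1)\<close>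
  for all \<open>i\<close>.
\<close>

section \<open>The product set and its chain of agreement relations\<close>

text \<open>Describing the blocks by intersection sizes lets all counting proceed without
  stabilisers; that they form one orbit then follows from transitivity on flags. The last coordinate
  is the one split off because a permutation preserving the chain permutes its slices, while the
  choices made inside different slices, of sets or of maps, are independent. Write E_i = e_1 ... e_i
  and c = (k - 1) / (v - 1). If j = i + 1 is the last coordinate in which two points differ, then of
  the b k / v blocks through the first point the fraction (f_j - 1) y_i / ((e_j - 1) E_i) contains
  the second: such a block meets f_j - 1 of the e_j - 1 other subclasses, each in y_i of its E_i
  points. Numerator and denominator are y_j - y_i and E_j - E_i, so the fraction is c at every
  level. The divisibility assumptions make the f_j integers; 1 < k < v then yields 2 \<le> f_j \<le>
  e_j.\<close>

definition agree :: "nat \<Rightarrow> nat \<Rightarrow> (nat \<Rightarrow> nat) \<Rightarrow> (nat \<Rightarrow> nat) \<Rightarrow> bool" where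
  "agree s i x z \<longleftrightarrow> (\<forall>j\<in>{i<..s}. x j = z j)"

lemma agree_refl [simp]: "agree s i x x"
  by (simp add: agree_def)

lemma agree_self [simp]: "agree s s x z"
  by (simp add: agree_def)

lemma agree_0:
  assumes "x \<in> product_points s e" "z \<in> product_points s e"
  shows "agree s 0 x z \<longleftrightarrow> x = z"
proof
  assume "agree s 0 x z"
  then show "x = z"
    using assms unfolding product_points_def agree_def
    by (intro PiE_ext[of x "{1..s}" _ z]) auto
qed simp

text \<open>Level \<open>Suc s\<close> is excluded: agreement is trivial there and says nothing
  about the last coordinate.\<close>

lemma agree_Suc_upd:
  assumes "i \<le> s"
  shows "agree (Suc s) i (x(Suc s := a)) (z(Suc s := c)) \<longleftrightarrow> a = c \<and> agree s i x z"
proof -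
  have "{i<..Suc s} = insert (Suc s) {i<..s}"
    using assms by auto
  then show ?thesis
    by (auto simp: agree_def)
qed

lemma finite_product_points [simp]: "finite (product_points s e)"
  by (simp add: product_points_def finite_PiE)

lemma card_product_points: "card (product_points s e) = (\<Prod>i=1..s. e i)"
  by (simp add: product_points_def card_PiE)

lemma product_points_0: "product_points 0 e = {\<lambda>_. undefined}"
  by (simp add: product_points_def)

lemma upd_mem_product_points:
  assumes "x \<in> product_points s e" "a < e (Suc s)"
  shows "x(Suc s := a) \<in> product_points (Suc s) e"
  using assms unfolding product_points_def
  by (simp add: atLeastAtMostSuc_conv PiE_insert_eq) (use assms in force)

lemma product_points_SucE:
  assumes "w \<in> product_points (Suc s) e"
  obtains x a where "x \<in> product_points s e" "a < e (Suc s)" "w = x(Suc s := a)"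
  using assms unfolding product_points_def
  by (auto simp: atLeastAtMostSuc_conv PiE_insert_eq)

lemma product_points_undefined:
  "x \<in> product_points s e \<Longrightarrow> s < j \<Longrightarrow> x j = undefined"
  by (auto simp: product_points_def PiE_def extensional_def)

lemma upd_undefined_product_points:
  "x \<in> product_points s e \<Longrightarrow> x(Suc s := undefined) = x"
  by (simp add: fun_upd_idem product_points_undefined)

text \<open>Points of the shorter product are \<open>undefined\<close> at \<open>Suc s\<close>, so
  resetting that coordinate recovers the point from its extension.\<close>

lemma upd_eq_iff:
  assumes "x \<in> product_points s e" "z \<in> product_points s e"
  shows "x(Suc s := a) = z(Suc s := c) \<longleftrightarrow> x = z \<and> a = c"
  using assms by (metis fun_upd_same fun_upd_upd upd_undefined_product_points)

section \<open>Slices\<close>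

text \<open>The part of \<open>X\<close> with last coordinate \<open>a\<close>, moved into the
  product with one factor fewer so that induction on \<open>s\<close> applies to it.\<close>

definition slice :: "nat \<Rightarrow> (nat \<Rightarrow> nat) \<Rightarrow> (nat \<Rightarrow> nat) set \<Rightarrow> nat \<Rightarrow> (nat \<Rightarrow> nat) set" where
  "slice s e X a = {x \<in> product_points s e. x(Suc s := a) \<in> X}"

definition glue :: "nat \<Rightarrow> (nat \<Rightarrow> nat) \<Rightarrow> (nat \<Rightarrow> (nat \<Rightarrow> nat) set) \<Rightarrow> (nat \<Rightarrow> nat) set" where
  "glue s e h = (\<Union>a<e (Suc s). (\<lambda>x. x(Suc s := a)) ` h a)"

lemma slice_subset: "slice s e X a \<subseteq> product_points s e"
  by (auto simp: slice_def)

lemma finite_slice [simp]: "finite (slice s e X a)"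
  using slice_subset finite_product_points by (rule finite_subset)

lemma glue_subset:
  assumes "\<And>a. a < e (Suc s) \<Longrightarrow> h a \<subseteq> product_points s e"
  shows "glue s e h \<subseteq> product_points (Suc s) e"
  using assms by (force simp: glue_def intro: upd_mem_product_points)

lemma glue_slice:
  assumes "X \<subseteq> product_points (Suc s) e"
  shows "glue s e (slice s e X) = X"
proof
  show "glue s e (slice s e X) \<subseteq> X"
    by (auto simp: glue_def slice_def)
  show "X \<subseteq> glue s e (slice s e X)"
  proof
    fix w assume "w \<in> X"
    moreover from this obtain x a
      where "x \<in> product_points s e" "a < e (Suc s)" "w = x(Suc s := a)"
      using assms product_points_SucE by blast
    ultimately show "w \<in> glue s e (slice s e X)"
      by (auto simp: glue_def slice_def)
  qed
qed

lemma slice_glue: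
  assumes "\<And>a. a < e (Suc s) \<Longrightarrow> h a \<subseteq> product_points s e" "a < e (Suc s)"
  shows "slice s e (glue s e h) a = h a"
proof
  show "slice s e (glue s e h) a \<subseteq> h a"
  proof
    fix x assume "x \<in> slice s e (glue s e h) a"
    then obtain c z where "x \<in> product_points s e" "c < e (Suc s)" "z \<in> h c"
      "x(Suc s := a) = z(Suc s := c)"
      by (auto simp: slice_def glue_def)
    then show "x \<in> h a"
      using assms(1) upd_eq_iff by (metis subsetD)
  qed
  show "h a \<subseteq> slice s e (glue s e h) a"
    using assms by (auto simp: slice_def glue_def)
qed

lemma subset_iff_slice:
  assumes "W \<subseteq> product_points (Suc s) e"
  shows "W \<subseteq> X \<longleftrightarrow> (\<forall>a<e (Suc s). slice s e W a \<subseteq> slice s e X a)"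
proof
  assume "\<forall>a<e (Suc s). slice s e W a \<subseteq> slice s e X a"
  then have "glue s e (slice s e W) \<subseteq> X"
    by (auto simp: glue_def slice_def)
  then show "W \<subseteq> X"
    by (simp add: glue_slice assms)
qed (auto simp: slice_def)

lemma card_eq_sum_slices:
  assumes "X \<subseteq> product_points (Suc s) e"
  shows "card X = (\<Sum>a<e (Suc s). card (slice s e X a))"
proof -
  have "card X = card (\<Union>a<e (Suc s). (\<lambda>x. x(Suc s := a)) ` slice s e X a)"
    using glue_slice[OF assms] by (simp add: glue_def)
  also have "\<dots> = (\<Sum>a<e (Suc s). card ((\<lambda>x. x(Suc s := a)) ` slice s e X a))"
  proof (rule card_UN_disjoint, simp, simp, intro ballI impI)
    fix a c :: nat assume "a \<noteq> c"
    then show "(\<lambda>x. x(Suc s := a)) ` slice s e X a \<inter> (\<lambda>x. x(Suc s := c)) ` slice s e X c = {}"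
      by (auto dest!: fun_cong[where x = "Suc s"])
  qed
  also have "\<dots> = (\<Sum>a<e (Suc s). card (slice s e X a))"
    by (intro sum.cong refl card_image inj_onI) (metis slice_subset subsetD upd_eq_iff)
  finally show ?thesis .
qed

section \<open>Blocks\<close>

text \<open>The orbit of the base block, described by the sizes of the intersections with the classes
  of the chain.\<close>

definition array_blocks :: "nat \<Rightarrow> (nat \<Rightarrow> nat) \<Rightarrow> (nat \<Rightarrow> nat) \<Rightarrow> (nat \<Rightarrow> nat) set set" where
  "array_blocks s e f = {X. X \<subseteq> product_points s e \<and> X \<noteq> {} \<and>
     (\<forall>x\<in>X. \<forall>i\<le>s. card {z \<in> X. agree s i x z} = (\<Prod>j=1..i. f j))}"

lemma array_blocks_subset: "X \<in> array_blocks s e f \<Longrightarrow> X \<subseteq> product_points s e"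
  by (simp add: array_blocks_def)

lemma array_blocks_nonempty [simp]: "{} \<notin> array_blocks s e f"
  by (simp add: array_blocks_def)

lemma finite_array_blocks [simp]: "finite (array_blocks s e f)"
  by (rule finite_subset[of _ "Pow (product_points s e)"]) (auto simp: array_blocks_def)

lemma card_array_blocks:
  assumes "X \<in> array_blocks s e f"
  shows "card X = (\<Prod>j=1..s. f j)"
proof -
  obtain x where "x \<in> X"
    using assms by (auto simp: array_blocks_def)
  then have "card {z \<in> X. agree s s x z} = (\<Prod>j=1..s. f j)"
    using assms unfolding array_blocks_def by blast
  then show ?thesis
    by simp
qed

lemma array_blocks_0: "array_blocks 0 e f = {{\<lambda>_. undefined}}"
  by (auto simp: array_blocks_def product_points_0)

text \<open>For \<open>i \<le> s\<close> agreement includes the last coordinate, so the whole class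
  lies in one slice.\<close>

lemma card_agree_upd:
  assumes "X \<subseteq> product_points (Suc s) e" "i \<le> s"
    "x \<in> product_points s e" "a < e (Suc s)"
  shows "card {z \<in> X. agree (Suc s) i (x(Suc s := a)) z}
    = card {z \<in> slice s e X a. agree s i x z}"
proof -
  have "{z \<in> X. agree (Suc s) i (x(Suc s := a)) z}
      = (\<lambda>z. z(Suc s := a)) ` {z \<in> slice s e X a. agree s i x z}" (is "?L = ?R")
  proof
    show "?L \<subseteq> ?R"
    proof
      fix w assume w: "w \<in> ?L"
      then obtain z c where z: "z \<in> product_points s e" "w = z(Suc s := c)"
        using assms(1) by (metis (no_types, lifting) mem_Collect_eq product_points_SucE subsetD)
      then have "c = a" "agree s i x z"
        using w agree_Suc_upd[OF assms(2)] by auto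
      then show "w \<in> ?R"
        using w z by (auto simp: slice_def)
    qed
    show "?R \<subseteq> ?L"
      using assms(2) by (auto simp: slice_def agree_Suc_upd)
  qed
  moreover have "inj_on (\<lambda>z. z(Suc s := a)) {z \<in> slice s e X a. agree s i x z}"
    by (intro inj_onI) (metis (no_types, lifting) mem_Collect_eq slice_subset subsetD upd_eq_iff)
  ultimately show ?thesis
    by (simp add: card_image)
qed

text \<open>Conditions at levels up to \<open>s\<close> only concern single slices. The one
  remaining condition, at level \<open>Suc s\<close>, prescribes the total size, which amounts to
  prescribing the number of nonempty slices because all of these have the same positive
  size.\<close>

lemma array_blocks_Suc_iff:
  assumes X: "X \<subseteq> product_points (Suc s) e" and f: "\<And>j. j \<in> {1..Suc s} \<Longrightarrow> f j > 0"
  shows "X \<in> array_blocks (Suc s) e f \<longleftrightarrow>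
    (\<forall>a<e (Suc s). slice s e X a \<in> insert {} (array_blocks s e f)) \<and>
    card {a. a < e (Suc s) \<and> slice s e X a \<noteq> {}} = f (Suc s)" (is "_ \<longleftrightarrow> ?slices \<and> ?num")
proof -
  define A where "A = {a. a < e (Suc s) \<and> slice s e X a \<noteq> {}}"
  define y where "y = (\<Prod>j=1..s. f j)"
  have ypos: "y > 0"
    using f by (auto simp: y_def intro!: prod_pos)
  have ySuc: "(\<Prod>j=1..Suc s. f j) = y * f (Suc s)"
    by (simp add: y_def)
  \<comment> \<open>Serves both directions: forwards \<open>y\<close> is cancelled to obtain
    \<open>card A\<close>, backwards it yields the intersection size at level
    \<open>Suc s\<close>.\<close>
  have cardX: "card X = y * card A" if ?slices
  proof -
    have "card X = (\<Sum>a<e (Suc s). card (slice s e X a))"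
      by (rule card_eq_sum_slices[OF X])
    also have "\<dots> = (\<Sum>a\<in>A. card (slice s e X a))"
      by (rule sum.mono_neutral_right) (auto simp: A_def)
    also have "\<dots> = (\<Sum>a\<in>A. y)"
      using that by (intro sum.cong) (auto simp: A_def y_def card_array_blocks)
    finally show ?thesis
      by simp
  qed
  have nonempty: "X \<noteq> {} \<longleftrightarrow> A \<noteq> {}"
  proof -
    have "X = {} \<longleftrightarrow> card X = 0"
      using X finite_subset[OF X] by auto
    also have "\<dots> \<longleftrightarrow> A = {}"
      by (auto simp: card_eq_sum_slices[OF X] A_def)
    finally show ?thesis by blast
  qed
  show ?thesis
  proof
    assume L: "X \<in> array_blocks (Suc s) e f"
    have slices: ?slices
    proof (intro allI impI)
      fix a assume a: "a < e (Suc s)"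
      have "card {z \<in> slice s e X a. agree s i x z} = (\<Prod>j=1..i. f j)"
        if "x \<in> slice s e X a" "i \<le> s" for x i
      proof -
        have "x \<in> product_points s e" "x(Suc s := a) \<in> X"
          using that by (auto simp: slice_def)
        moreover from this have
          "card {z \<in> X. agree (Suc s) i (x(Suc s := a)) z} = (\<Prod>j=1..i. f j)"
          using L that by (simp add: array_blocks_def)
        ultimately show ?thesis
          using card_agree_upd[OF X \<open>i \<le> s\<close> _ a, of x] by simp
      qed
      then show "slice s e X a \<in> insert {} (array_blocks s e f)"
        using slice_subset by (auto simp: array_blocks_def)
    qed
    moreover have "y * card A = y * f (Suc s)"
      using card_array_blocks[OF L] cardX[OF slices] ySuc by simp
    ultimately show "?slices \<and> ?num"
      using ypos by (simp add: A_def)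
  next
    assume R: "?slices \<and> ?num"
    then have cA: "card A = f (Suc s)"
      by (simp add: A_def)
    have "card {z \<in> X. agree (Suc s) i w z} = (\<Prod>j=1..i. f j)" if w: "w \<in> X" and i: "i \<le> Suc s" for w i
    proof (cases "i = Suc s")
      case True
      have "card X = (\<Prod>j=1..Suc s. f j)"
        unfolding ySuc using R cardX cA by simp
      with True show ?thesis
        by simp
    next
      case False
      then have i: "i \<le> s" using i by simp
      obtain x a where x: "x \<in> product_points s e" "a < e (Suc s)" "w = x(Suc s := a)"
        using w X product_points_SucE by blast
      then have "x \<in> slice s e X a"
        using w by (simp add: slice_def)
      moreover from this have "slice s e X a \<in> array_blocks s e f"
        using R x by auto
      ultimately show ?thesis
        using i card_agree_upd[OF X i x(1,2)] x(3) by (simp add: array_blocks_def)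
    qed
    moreover have "X \<noteq> {}"
      using nonempty cA f[of "Suc s"] by auto
    ultimately show "X \<in> array_blocks (Suc s) e f"
      using X by (simp add: array_blocks_def)
  qed
qed

text \<open>The bound \<open>f j \<le> e j\<close> puts the box of side lengths \<open>f j\<close>
  inside the product, so that its intersections with classes are boxes too.\<close>

lemma base_block_array_blocks:
  assumes f: "\<And>j. j \<in> {1..s} \<Longrightarrow> 0 < f j \<and> f j \<le> e j"
  shows "{\<delta> \<in> product_points s e. \<forall>i\<in>{1..s}. \<delta> i < f i} \<in> array_blocks s e f" (is "?B \<in> _")
proof -
  have B: "?B = (\<Pi>\<^sub>E j\<in>{1..s}. {0..<f j})"
  proof (intro equalityI subsetI)
    fix x assume "x \<in> (\<Pi>\<^sub>E j\<in>{1..s}. {0..<f j})"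
    then have "x i < f i \<and> x i < e i" if "i \<in> {1..s}" for i
      using f[OF that] that by (auto simp: PiE_iff intro: less_le_trans)
    then show "x \<in> ?B"
      using \<open>x \<in> _\<close> by (simp add: product_points_def PiE_iff)
  qed (simp add: product_points_def PiE_iff)
  have "card {z \<in> ?B. agree s i x z} = (\<Prod>j=1..i. f j)" if x: "x \<in> ?B" and i: "i \<le> s" for x i
  proof -
    \<comment> \<open>Agreement with \<open>x\<close> beyond \<open>i\<close> freezes the upper
      coordinates and leaves the lower ones free.\<close>
    have "{z \<in> ?B. agree s i x z} = (\<Pi>\<^sub>E j\<in>{1..s}. if j \<le> i then {0..<f j} else {x j})"
    proof (intro equalityI subsetI)
      fix z assume "z \<in> {z \<in> ?B. agree s i x z}"
      then show "z \<in> (\<Pi>\<^sub>E j\<in>{1..s}. if j \<le> i then {0..<f j} else {x j})"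
        unfolding B by (auto simp: agree_def PiE_iff extensional_def)
    next
      fix z assume z: "z \<in> (\<Pi>\<^sub>E j\<in>{1..s}. if j \<le> i then {0..<f j} else {x j})"
      have zj: "z j < f j \<and> (i < j \<longrightarrow> x j = z j)" if "j \<in> {1..s}" for j
      proof -
        have "x j < f j" using x that by auto
        moreover have "z j \<in> (if j \<le> i then {0..<f j} else {x j})"
          using z that by (rule PiE_mem)
        ultimately show ?thesis by (auto split: if_splits)
      qed
      moreover have "z \<in> extensional {1..s}"
        using z by (simp add: PiE_def)
      ultimately show "z \<in> {z \<in> ?B. agree s i x z}"
        unfolding B by (auto simp: agree_def PiE_iff)
    qed
    then have "card {z \<in> ?B. agree s i x z} = (\<Prod>j=1..s. if j \<le> i then f j else 1)"
      by (simp add: card_PiE if_distrib[of card] cong: if_cong)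
    also have "\<dots> = (\<Prod>j=1..i. if j \<le> i then f j else 1)"
      using i by (intro prod.mono_neutral_right) auto
    finally show ?thesis
      by simp
  qed
  moreover have "?B \<noteq> {}"
    unfolding B using f by (auto simp: PiE_eq_empty_iff)
  ultimately show ?thesis
    by (auto simp: array_blocks_def)
qed

section \<open>Counting blocks\<close>

lemma card_subsets_containing:
  assumes "finite A" "T \<subseteq> A" "card T \<le> n"
  shows "card {S. T \<subseteq> S \<and> S \<subseteq> A \<and> card S = n} = (card A - card T) choose (n - card T)"
proof -
  have fT: "finite T"
    using assms finite_subset by blast
  have "bij_betw (\<lambda>S. S \<union> T) {S. S \<subseteq> A - T \<and> card S = n - card T}
      {S. T \<subseteq> S \<and> S \<subseteq> A \<and> card S = n}"
  proof (rule bij_betwI[where g = "\<lambda>S. S - T"])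
    show "(\<lambda>S. S \<union> T) \<in> {S. S \<subseteq> A - T \<and> card S = n - card T} \<rightarrow>
        {S. T \<subseteq> S \<and> S \<subseteq> A \<and> card S = n}"
    proof
      fix S assume "S \<in> {S. S \<subseteq> A - T \<and> card S = n - card T}"
      moreover from this have "card (S \<union> T) = card S + card T"
        using assms fT by (intro card_Un_disjoint) (auto intro: finite_subset)
      ultimately show "S \<union> T \<in> {S. T \<subseteq> S \<and> S \<subseteq> A \<and> card S = n}"
        using assms by auto
    qed
    show "(\<lambda>S. S - T) \<in> {S. T \<subseteq> S \<and> S \<subseteq> A \<and> card S = n} \<rightarrow>
        {S. S \<subseteq> A - T \<and> card S = n - card T}"
      using fT by (auto simp: card_Diff_subset)
  qed auto
  then have "card {S. T \<subseteq> S \<and> S \<subseteq> A \<and> card S = n} = card {S. S \<subseteq> A - T \<and> card S = n - card T}"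
    by (rule bij_betw_same_card[symmetric])
  also have "\<dots> = card (A - T) choose (n - card T)"
    using assms by (intro n_subsets) auto
  finally show ?thesis
    using assms fT by (simp add: card_Diff_subset)
qed

text \<open>Here \<open>Q\<close> stands for the possible nonempty slices and \<open>W a\<close> for
  the points prescribed in slice \<open>a\<close>. The functions are sorted by support: it must
  contain \<open>T\<close>, and on the rest of the support nothing is prescribed, which gives the
  power of \<open>card Q\<close>.\<close>

lemma card_choice_functions:
  assumes A: "finite A" and Q: "finite Q" "{} \<notin> Q"
    and T: "T = {a \<in> A. W a \<noteq> {}}" "card T \<le> n"
  shows "card {h \<in> (\<Pi>\<^sub>E a\<in>A. insert {} Q). card {a \<in> A. h a \<noteq> {}} = n \<and> (\<forall>a\<in>A. W a \<subseteq> h a)}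
    = ((card A - card T) choose (n - card T)) * card Q ^ (n - card T) *
      (\<Prod>a\<in>T. card {Y \<in> Q. W a \<subseteq> Y})" (is "card ?H = _")
proof -
  \<comment> \<open>Since \<open>{}\<close> is not in \<open>Q\<close>, members of
    \<open>F S\<close> have support exactly \<open>S\<close>, which makes the union over
    \<open>S\<close> disjoint.\<close>
  define F where "F S = (\<Pi>\<^sub>E a\<in>A. if a \<in> S then {Y \<in> Q. W a \<subseteq> Y} else {{}})" for S
  define Ss where "Ss = {S. T \<subseteq> S \<and> S \<subseteq> A \<and> card S = n}"
  have fin: "finite Ss"
    using A by (auto simp: Ss_def)
  have supp: "{a \<in> A. h a \<noteq> {}} = S" if "h \<in> F S" "S \<in> Ss" for h S
  proof -
    have "h a \<in> (if a \<in> S then {Y \<in> Q. W a \<subseteq> Y} else {{}})" if "a \<in> A" for a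
      using \<open>h \<in> F S\<close> that unfolding F_def by (rule PiE_mem)
    then show ?thesis
      using Q \<open>S \<in> Ss\<close> unfolding Ss_def by (fastforce split: if_splits)
  qed
  have H: "?H = (\<Union>S\<in>Ss. F S)"
  proof (intro equalityI subsetI)
    fix h assume h: "h \<in> ?H"
    define S where "S = {a \<in> A. h a \<noteq> {}}"
    have "S \<in> Ss"
      using h by (auto simp: Ss_def S_def T)
    moreover have "h \<in> F S"
      using h by (auto simp: F_def S_def PiE_iff)
    ultimately show "h \<in> (\<Union>S\<in>Ss. F S)"
      by blast
  next
    fix h assume "h \<in> (\<Union>S\<in>Ss. F S)"
    then obtain S where S: "S \<in> Ss" "h \<in> F S"
      by blast
    have "W a \<subseteq> h a \<and> h a \<in> insert {} Q" if "a \<in> A" for a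
    proof -
      have "h a \<in> (if a \<in> S then {Y \<in> Q. W a \<subseteq> Y} else {{}})"
        using S that unfolding F_def by blast
      then show ?thesis
        using S that by (cases "a \<in> S") (auto simp: Ss_def T)
    qed
    moreover have "h \<in> extensional A"
      using S by (auto simp: F_def PiE_def)
    ultimately show "h \<in> ?H"
      using S supp[OF S(2,1)] by (auto simp: PiE_iff Ss_def)
  qed
  have "card ?H = (\<Sum>S\<in>Ss. card (F S))"
    unfolding H
  proof (rule card_UN_disjoint[OF fin])
    show "\<forall>S\<in>Ss. finite (F S)"
      using A Q by (auto simp: F_def intro!: finite_PiE)
    show "\<forall>S\<in>Ss. \<forall>S'\<in>Ss. S \<noteq> S' \<longrightarrow> F S \<inter> F S' = {}"
      using supp by blast
  qed
  also have "\<dots> = (\<Sum>S\<in>Ss. card Q ^ (n - card T) * (\<Prod>a\<in>T. card {Y \<in> Q. W a \<subseteq> Y}))"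
  proof (rule sum.cong[OF refl])
    fix S assume S: "S \<in> Ss"
    then have finS: "finite S" and TS: "T \<subseteq> S" "S \<subseteq> A"
      using A by (auto simp: Ss_def intro: finite_subset)
    have "card (F S) = (\<Prod>a\<in>A. card (if a \<in> S then {Y \<in> Q. W a \<subseteq> Y} else {{}}))"
      using A by (simp add: F_def card_PiE)
    also have "\<dots> = (\<Prod>a\<in>S. card {Y \<in> Q. W a \<subseteq> Y})"
      using TS by (intro prod.mono_neutral_cong_right[OF A]) auto
    also have "\<dots> = (\<Prod>a\<in>S - T. card {Y \<in> Q. W a \<subseteq> Y}) * (\<Prod>a\<in>T. card {Y \<in> Q. W a \<subseteq> Y})"
      by (rule prod.subset_diff[OF TS(1) finS])
    also have "(\<Prod>a\<in>S - T. card {Y \<in> Q. W a \<subseteq> Y}) = (\<Prod>a\<in>S - T. card Q)"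
      using TS by (intro prod.cong refl) (auto simp: T)
    also have "\<dots> = card Q ^ (n - card T)"
      using S finS TS finite_subset[OF TS(1) finS] by (simp add: card_Diff_subset Ss_def)
    finally show "card (F S) = card Q ^ (n - card T) * (\<Prod>a\<in>T. card {Y \<in> Q. W a \<subseteq> Y})" .
  qed
  also have "\<dots> = card Ss * (card Q ^ (n - card T) * (\<Prod>a\<in>T. card {Y \<in> Q. W a \<subseteq> Y}))"
    by simp
  also have "card Ss = (card A - card T) choose (n - card T)"
    unfolding Ss_def using A T by (intro card_subsets_containing) auto
  finally show ?thesis
    by (simp add: mult.assoc)
qed

text \<open>One recursion for all three counts: \<open>W\<close> is later empty, a point, or a pair
  of points. The bound on \<open>card T\<close> keeps the differences of naturals from being
  truncated.\<close>

lemma card_array_blocks_Suc_containing: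
  assumes W: "W \<subseteq> product_points (Suc s) e" and f: "\<And>j. j \<in> {1..Suc s} \<Longrightarrow> f j > 0"
    and T: "T = {a. a < e (Suc s) \<and> slice s e W a \<noteq> {}}" "card T \<le> f (Suc s)"
  shows "card {X \<in> array_blocks (Suc s) e f. W \<subseteq> X}
    = ((e (Suc s) - card T) choose (f (Suc s) - card T)) *
      card (array_blocks s e f) ^ (f (Suc s) - card T) *
      (\<Prod>a\<in>T. card {Y \<in> array_blocks s e f. slice s e W a \<subseteq> Y})"
proof -
  define Q where "Q = array_blocks s e f"
  define A where "A = {..<e (Suc s)}"
  define H where "H = {h \<in> (\<Pi>\<^sub>E a\<in>A. insert {} Q).
    card {a \<in> A. h a \<noteq> {}} = f (Suc s) \<and> (\<forall>a\<in>A. slice s e W a \<subseteq> h a)}"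
  \<comment> \<open>Restricting to \<open>A\<close> makes a family of slices extensional, so that
    gluing is a genuine inverse.\<close>
  define sl where "sl X = restrict (slice s e X) A" for X
  have Hsub: "h a \<subseteq> product_points s e" if "h \<in> H" "a < e (Suc s)" for h a
  proof -
    have "h a \<in> insert {} Q"
      using that by (auto simp: H_def A_def)
    then show ?thesis
      using array_blocks_subset[of "h a" s e f] by (auto simp: Q_def)
  qed
  have "bij_betw sl {X \<in> array_blocks (Suc s) e f. W \<subseteq> X} H"
  proof (rule bij_betwI[where g = "glue s e"])
    show "sl \<in> {X \<in> array_blocks (Suc s) e f. W \<subseteq> X} \<rightarrow> H"
    proof
      fix X assume "X \<in> {X \<in> array_blocks (Suc s) e f. W \<subseteq> X}"
      moreover from this have "X \<subseteq> product_points (Suc s) e"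
        using array_blocks_subset by blast
      moreover have "{a \<in> A. sl X a \<noteq> {}} = {a. a < e (Suc s) \<and> slice s e X a \<noteq> {}}"
        by (auto simp: A_def sl_def)
      ultimately show "sl X \<in> H"
        using array_blocks_Suc_iff[of X s e f] subset_iff_slice[OF W, of X] f
        by (auto simp: H_def sl_def A_def Q_def PiE_iff)
    qed
    show "glue s e \<in> H \<rightarrow> {X \<in> array_blocks (Suc s) e f. W \<subseteq> X}"
    proof
      fix h assume h: "h \<in> H"
      have sub: "glue s e h \<subseteq> product_points (Suc s) e"
        by (rule glue_subset) (rule Hsub[OF h])
      have sg: "slice s e (glue s e h) a = h a" if "a < e (Suc s)" for a
        using slice_glue[OF Hsub[OF h] that] .
      have "{a. a < e (Suc s) \<and> slice s e (glue s e h) a \<noteq> {}} = {a \<in> A. h a \<noteq> {}}"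
        using sg by (auto simp: A_def)
      then have "glue s e h \<in> array_blocks (Suc s) e f"
        using array_blocks_Suc_iff[OF sub f] h sg by (auto simp: H_def A_def Q_def)
      moreover have "W \<subseteq> glue s e h"
        using subset_iff_slice[OF W] sg h by (auto simp: H_def A_def)
      ultimately show "glue s e h \<in> {X \<in> array_blocks (Suc s) e f. W \<subseteq> X}"
        by simp
    qed
    show "glue s e (sl X) = X" if "X \<in> {X \<in> array_blocks (Suc s) e f. W \<subseteq> X}" for X
    proof -
      have "glue s e (sl X) = glue s e (slice s e X)"
        by (auto simp: glue_def sl_def A_def)
      then show ?thesis
        using that glue_slice array_blocks_subset by auto
    qed
    show "sl (glue s e h) = h" if h: "h \<in> H" for h
    proof (rule extensionalityI[of _ A])
      show "sl (glue s e h) \<in> extensional A" by (simp add: sl_def)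
      show "h \<in> extensional A" using h by (simp add: H_def PiE_def)
      show "sl (glue s e h) a = h a" if "a \<in> A" for a
        using that slice_glue[OF Hsub[OF h]] by (simp add: sl_def A_def)
    qed
  qed
  then have "card {X \<in> array_blocks (Suc s) e f. W \<subseteq> X} = card H"
    by (rule bij_betw_same_card)
  also have "\<dots> = ((card A - card T) choose (f (Suc s) - card T)) *
      card Q ^ (f (Suc s) - card T) * (\<Prod>a\<in>T. card {Y \<in> Q. slice s e W a \<subseteq> Y})"
    unfolding H_def using T
    by (intro card_choice_functions) (auto simp: Q_def A_def)
  finally show ?thesis
    by (simp add: A_def Q_def)
qed

lemma card_array_blocks_Suc:
  assumes "\<And>j. j \<in> {1..Suc s} \<Longrightarrow> f j > 0"
  shows "card (array_blocks (Suc s) e f)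
    = (e (Suc s) choose f (Suc s)) * card (array_blocks s e f) ^ f (Suc s)"
  using card_array_blocks_Suc_containing[of "{}" s e f "{}"] assms
  by (simp add: slice_def)

text \<open>The exponent is the number of level-\<open>j\<close> classes that a block meets; in each
  of them \<open>f j\<close> of the \<open>e j\<close> subclasses are chosen independently.\<close>

lemma card_array_blocks_eq_prod:
  assumes "\<And>j. j \<in> {1..s} \<Longrightarrow> f j > 0"
  shows "card (array_blocks s e f) = (\<Prod>j=1..s. (e j choose f j) ^ (\<Prod>i\<in>{j<..s}. f i))"
  using assms
proof (induction s)
  case 0
  then show ?case by (simp add: array_blocks_0)
next
  case (Suc s)
  have "(\<Prod>i\<in>{j<..Suc s}. f i) = (\<Prod>i\<in>{j<..s}. f i) * f (Suc s)" if "j \<in> {1..s}" for j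
  proof -
    have "{j<..Suc s} = insert (Suc s) {j<..s}" using that by auto
    then show ?thesis by simp
  qed
  then have "(\<Prod>j=1..s. (e j choose f j) ^ (\<Prod>i\<in>{j<..Suc s}. f i))
      = (\<Prod>j=1..s. (e j choose f j) ^ (\<Prod>i\<in>{j<..s}. f i)) ^ f (Suc s)"
    by (simp add: power_mult prod_power_distrib)
  with Suc.IH Suc.prems card_array_blocks_Suc[of s f e] show ?case
    by (simp add: mult.commute)
qed

section \<open>Blocks through one point and through two points\<close>

lemma slice_empty [simp]: "slice s e {} a = {}"
  by (simp add: slice_def)

lemma slice_insert:
  assumes "x \<in> product_points s e"
  shows "slice s e (insert (x(Suc s := a)) W) c
    = (if c = a then insert x (slice s e W c) else slice s e W c)"
  using assms by (auto simp: slice_def upd_eq_iff)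

text \<open>This is \<open>r * v = b * k\<close>, multiplied out to stay in the naturals. It comes
  from the recursion and the absorption identity for binomials instead of from point-transitivity,
  which is itself deduced from it later.\<close>

lemma card_array_blocks_containing_point:
  assumes "\<And>j. j \<in> {1..s} \<Longrightarrow> 0 < f j \<and> f j \<le> e j" "x \<in> product_points s e"
  shows "card {X \<in> array_blocks s e f. x \<in> X} * (\<Prod>j=1..s. e j)
    = card (array_blocks s e f) * (\<Prod>j=1..s. f j)"
  using assms
proof (induction s arbitrary: x)
  case 0
  then have "{X \<in> array_blocks 0 e f. x \<in> X} = array_blocks 0 e f"
    by (auto simp: array_blocks_0 product_points_0)
  then show ?case by simp
next
  case (Suc s)
  define F E N where "F = f (Suc s)" and "E = e (Suc s)" and "N = card (array_blocks s e f)"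
  have F: "0 < F" "F \<le> E"
    using Suc.prems(1)[of "Suc s"] by (auto simp: F_def E_def)
  obtain z a where z: "z \<in> product_points s e" "a < e (Suc s)" "x = z(Suc s := a)"
    using Suc.prems product_points_SucE by blast
  have W: "{x} \<subseteq> product_points (Suc s) e"
    using Suc.prems by simp
  have fpos: "0 < f j" if "j \<in> {1..Suc s}" for j
    using Suc.prems(1)[OF that] by simp
  have sl: "slice s e {x} c = (if c = a then {z} else {})" for c
    unfolding z(3) using z(1) by (simp add: slice_insert)
  have T: "{c. c < e (Suc s) \<and> slice s e {x} c \<noteq> {}} = {a}"
    using z(2) by (auto simp: sl)
  have "card {X \<in> array_blocks (Suc s) e f. {x} \<subseteq> X}
      = ((E - 1) choose (F - 1)) * N ^ (F - 1) * card {Y \<in> array_blocks s e f. z \<in> Y}"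
    using card_array_blocks_Suc_containing[where f = f, OF W fpos T[symmetric]] F
    by (simp add: sl F_def E_def N_def)
  then have "card {X \<in> array_blocks (Suc s) e f. x \<in> X} * (\<Prod>j=1..Suc s. e j)
      = (E * ((E - 1) choose (F - 1))) * N ^ (F - 1) *
        (card {Y \<in> array_blocks s e f. z \<in> Y} * (\<Prod>j=1..s. e j))"
    by (simp add: E_def)
  also have "E * ((E - 1) choose (F - 1)) = F * (E choose F)"
    using F by (simp add: times_binomial_minus1_eq)
  also have "card {Y \<in> array_blocks s e f. z \<in> Y} * (\<Prod>j=1..s. e j) = N * (\<Prod>j=1..s. f j)"
    using Suc z by (simp add: N_def)
  also have "F * (E choose F) * N ^ (F - 1) * (N * (\<Prod>j=1..s. f j))
      = (E choose F) * (N * N ^ (F - 1)) * (F * (\<Prod>j=1..s. f j))"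
    by (simp add: mult_ac)
  also have "N * N ^ (F - 1) = N ^ F"
    using F by (simp add: power_eq_if)
  finally show ?case
    using card_array_blocks_Suc[where f = f, OF fpos] by (simp add: F_def E_def N_def mult_ac)
qed

text \<open>The constant \<open>c\<close> is abstract because the induction descends to shorter
  products with the same \<open>c\<close>, whereas the point number and the block size change. For
  points in a common slice the recursion contributes the same factor to both sides; for points in
  different slices the count reduces to blocks through single points.\<close>

lemma card_array_blocks_containing_pair:
  fixes c :: real
  assumes f: "\<And>j. j \<in> {1..s} \<Longrightarrow> 2 \<le> f j \<and> f j \<le> e j"
    and c: "\<And>i. i \<le> s \<Longrightarrow> real (\<Prod>j=1..i. f j) = 1 + c * (real (\<Prod>j=1..i. e j) - 1)"
    and xz: "x \<in> product_points s e" "z \<in> product_points s e" "x \<noteq> z"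
  shows "real (card {X \<in> array_blocks s e f. x \<in> X \<and> z \<in> X}) * real (\<Prod>j=1..s. e j)
    = real (card (array_blocks s e f)) * real (\<Prod>j=1..s. f j) * c"
  using assms
proof (induction s arbitrary: x z)
  case 0
  then show ?case by (simp add: product_points_0)
next
  case (Suc s)
  define F E N where "F = f (Suc s)" and "E = e (Suc s)" and "N = card (array_blocks s e f)"
  define Es ys where "Es = (\<Prod>j=1..s. e j)" and "ys = (\<Prod>j=1..s. f j)"
  have F: "2 \<le> F" "F \<le> E"
    using Suc.prems(1)[of "Suc s"] by (auto simp: F_def E_def)
  have fpos: "0 < f j" if "j \<in> {1..Suc s}" for j
    using Suc.prems(1)[OF that] by simp
  have fpos': "0 < f j \<and> f j \<le> e j" if "j \<in> {1..s}" for j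
    using Suc.prems(1)[of j] that by simp
  have epos: "0 < e j" if "j \<in> {1..s}" for j
    using fpos'[OF that] by simp
  have EsPos: "0 < Es"
    unfolding Es_def using epos by (intro prod_pos) auto
  have N': "card (array_blocks (Suc s) e f) = (E choose F) * N ^ F"
    using card_array_blocks_Suc[where f = f, OF fpos] by (simp add: F_def E_def N_def)
  have bin1: "E * ((E - 1) choose (F - 1)) = F * (E choose F)"
    using F by (simp add: times_binomial_minus1_eq)
  have bin2: "(E - 1) * ((E - 2) choose (F - 2)) = (F - 1) * ((E - 1) choose (F - 1))"
    using F times_binomial_minus1_eq[of "F - 1" "E - 1"]
    by (simp add: numeral_2_eq_2)
  obtain x' a where x: "x' \<in> product_points s e" "a < e (Suc s)" "x = x'(Suc s := a)"
    using Suc.prems product_points_SucE by blast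
  obtain z' a' where z: "z' \<in> product_points s e" "a' < e (Suc s)" "z = z'(Suc s := a')"
    using Suc.prems product_points_SucE by blast
  have W: "{x, z} \<subseteq> product_points (Suc s) e"
    using Suc.prems by simp
  have sl: "slice s e {x, z} b = (if b = a then {x'} else {}) \<union> (if b = a' then {z'} else {})" for b
    unfolding x(3) z(3) using x(1) z(1) by (simp add: slice_insert)
  have goal: "real (card {X \<in> array_blocks (Suc s) e f. {x, z} \<subseteq> X}) * (real Es * real E)
    = real (E choose F) * real N ^ F * (real ys * real F) * c"
  proof (cases "a = a'")
    case True
    then have "x' \<noteq> z'"
      using Suc.prems x z by auto
    have IH: "real (card {Y \<in> array_blocks s e f. x' \<in> Y \<and> z' \<in> Y}) * real Es
        = real N * real ys * c"
      unfolding N_def Es_def ys_def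
      by (rule Suc.IH) (use Suc.prems x z \<open>x' \<noteq> z'\<close> in auto)
    have T: "{b. b < e (Suc s) \<and> slice s e {x, z} b \<noteq> {}} = {a}"
      using x(2) True by (auto simp: sl)
    have "card {X \<in> array_blocks (Suc s) e f. {x, z} \<subseteq> X}
        = ((E - 1) choose (F - 1)) * N ^ (F - 1) *
          card {Y \<in> array_blocks s e f. x' \<in> Y \<and> z' \<in> Y}"
      using card_array_blocks_Suc_containing[where f = f, OF W fpos T[symmetric]] F True
      by (simp add: sl F_def E_def N_def conj_commute)
    then have "real (card {X \<in> array_blocks (Suc s) e f. {x, z} \<subseteq> X}) * (real Es * real E)
        = real (E * ((E - 1) choose (F - 1))) * real N ^ (F - 1) *
          (real (card {Y \<in> array_blocks s e f. x' \<in> Y \<and> z' \<in> Y}) * real Es)"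
      by simp
    also have "\<dots> = real (E choose F) * (real N * real N ^ (F - 1)) * (real ys * real F) * c"
      unfolding bin1 IH by simp
    also have "real N * real N ^ (F - 1) = real N ^ F"
      using F by (simp add: power_eq_if)
    finally show ?thesis .
  next
    case False
    have r: "card {Y \<in> array_blocks s e f. w \<in> Y} * Es = N * ys" if "w \<in> product_points s e" for w
      unfolding N_def Es_def ys_def
      by (rule card_array_blocks_containing_point[where f = f, OF fpos' that])
    have T: "{b. b < e (Suc s) \<and> slice s e {x, z} b \<noteq> {}} = {a, a'}"
      using x(2) z(2) by (auto simp: sl)
    have "card {X \<in> array_blocks (Suc s) e f. {x, z} \<subseteq> X}
        = ((E - 2) choose (F - 2)) * N ^ (F - 2) *
          (card {Y \<in> array_blocks s e f. x' \<in> Y} * card {Y \<in> array_blocks s e f. z' \<in> Y})"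
      using card_array_blocks_Suc_containing[where f = f, OF W fpos T[symmetric]] F False
      by (simp add: sl F_def E_def N_def numeral_2_eq_2)
    \<comment> \<open>The extra factor \<open>(E - 1) * Es\<close> clears denominators: a second
      absorption step uses \<open>E - 1\<close>, and the second slice uses its own
      \<open>Es\<close>. It is nonzero and is cancelled at the end.\<close>
    then have "card {X \<in> array_blocks (Suc s) e f. {x, z} \<subseteq> X} * (Es * E) * ((E - 1) * Es)
        = E * ((E - 1) * ((E - 2) choose (F - 2))) * N ^ (F - 2) *
          (card {Y \<in> array_blocks s e f. x' \<in> Y} * Es) *
          (card {Y \<in> array_blocks s e f. z' \<in> Y} * Es)"
      by simp
    also have "\<dots> = (F - 1) * (E * ((E - 1) choose (F - 1))) * N ^ (F - 2) * (N * ys) * (N * ys)"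
      unfolding bin2 r[OF x(1)] r[OF z(1)] by simp
    also have "\<dots> = (E choose F) * (N * N * N ^ (F - 2)) * (ys * F) * ((F - 1) * ys)"
      unfolding bin1 by simp
    also have "N * N * N ^ (F - 2) = N ^ F"
      using F by (metis le_add_diff_inverse power2_eq_square power_add)
    finally have eq: "real (card {X \<in> array_blocks (Suc s) e f. {x, z} \<subseteq> X}) * (real Es * real E) *
        (real (E - 1) * real Es)
      = real (E choose F) * real N ^ F * (real ys * real F) * (real (F - 1) * real ys)"
      unfolding of_nat_mult[symmetric] of_nat_power[symmetric] of_nat_eq_iff .
    \<comment> \<open>The hypothesis on \<open>c\<close> at level \<open>Suc s\<close> minus the one
      at level \<open>s\<close>.\<close>
    have w: "real (F - 1) * real ys = c * (real (E - 1) * real Es)"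
      using Suc.prems(2)[of "Suc s"] Suc.prems(2)[of s] F
      by (simp add: F_def E_def Es_def ys_def of_nat_diff algebra_simps)
    have "real (E - 1) * real Es \<noteq> 0"
      using F EsPos by simp
    moreover have "real (card {X \<in> array_blocks (Suc s) e f. {x, z} \<subseteq> X}) * (real Es * real E) *
        (real (E - 1) * real Es)
      = real (E choose F) * real N ^ F * (real ys * real F) * c * (real (E - 1) * real Es)"
      unfolding eq w by (simp only: mult.assoc)
    ultimately show ?thesis
      by (simp only: mult_cancel_right simp_thms)
  qed
  have "(\<Prod>j=1..Suc s. e j) = Es * E" "(\<Prod>j=1..Suc s. f j) = ys * F"
    by (simp_all add: Es_def ys_def E_def F_def)
  then show ?case
    using goal N' by simp
qed

section \<open>The iterated wreath product\<close>

text \<open>Extensionality is left out so that maps can be assembled slice by slice; restricting to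
  the points at the end produces group elements.\<close>

definition chain_map :: "nat \<Rightarrow> (nat \<Rightarrow> nat) \<Rightarrow> ((nat \<Rightarrow> nat) \<Rightarrow> (nat \<Rightarrow> nat)) \<Rightarrow> bool" where
  "chain_map s e g \<longleftrightarrow> g \<in> product_points s e \<rightarrow> product_points s e \<and>
     (\<forall>x\<in>product_points s e. \<forall>z\<in>product_points s e. \<forall>i\<le>s.
        agree s i (g x) (g z) \<longleftrightarrow> agree s i x z)"

text \<open>At level 0 the equivalence is injectivity, and the point set is finite.\<close>

lemma chain_map_bij:
  assumes "chain_map s e g"
  shows "bij_betw g (product_points s e) (product_points s e)"
proof -
  have inj: "inj_on g (product_points s e)"
  proof (rule inj_onI)
    fix x z assume xz: "x \<in> product_points s e" "z \<in> product_points s e" and "g x = g z"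
    then have "agree s 0 (g x) (g z)"
      by simp
    then have "agree s 0 x z"
      using assms xz unfolding chain_map_def by blast
    then show "x = z"
      using agree_0[OF xz] by simp
  qed
  then show ?thesis
    using assms endo_inj_surj[of "product_points s e" g]
    by (auto simp: chain_map_def bij_betw_def)
qed

lemma chain_map_restrict [simp]:
  "chain_map s e (restrict g (product_points s e)) \<longleftrightarrow> chain_map s e g"
  by (simp add: chain_map_def Pi_iff)

lemma chain_map_id: "chain_map s e (\<lambda>x. x)"
  by (simp add: chain_map_def)

lemma chain_map_compose:
  assumes "chain_map s e g" "chain_map s e h"
  shows "chain_map s e (compose (product_points s e) g h)"
  using assms by (auto simp: chain_map_def compose_def Pi_iff)

lemma chain_map_inv_into:
  assumes "chain_map s e g"
  shows "chain_map s e (inv_into (product_points s e) g)"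
proof -
  let ?P = "product_points s e"
  note g = chain_map_bij[OF assms]
  have "inv_into ?P g \<in> ?P \<rightarrow> ?P"
    using bij_betw_inv_into[OF g] by (rule bij_betw_imp_funcset)
  moreover have "g (inv_into ?P g x) = x" if "x \<in> ?P" for x
    using g that by (simp add: bij_betw_inv_into_right)
  ultimately show ?thesis
    using assms unfolding chain_map_def by (metis (no_types, lifting) PiE Pi_iff)
qed

text \<open>Turns invariance of a set of classes into a pointwise condition: the image of the class
  of \<open>x\<close> is a class containing \<open>g x\<close>, hence the class of
  \<open>g x\<close>.\<close>

lemma image_quotient_eq_iff:
  assumes r: "equiv A r" and g: "bij_betw g A A"
  shows "(`) g ` (A // r) = A // r \<longleftrightarrow> (\<forall>x\<in>A. \<forall>z\<in>A. (g x, g z) \<in> r \<longleftrightarrow> (x, z) \<in> r)"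
proof
  have inA: "g x \<in> A" if "x \<in> A" for x
    using g that by (auto simp: bij_betw_def)
  have rA: "r \<subseteq> A \<times> A"
    using r by (auto simp: equiv_def refl_on_def)
  show "\<forall>x\<in>A. \<forall>z\<in>A. (g x, g z) \<in> r \<longleftrightarrow> (x, z) \<in> r" if eq: "(`) g ` (A // r) = A // r"
  proof (intro ballI)
    fix x z assume xz: "x \<in> A" "z \<in> A"
    have x: "x \<in> r `` {x}"
      using equiv_class_self[OF r xz(1)] .
    have "g ` (r `` {x}) \<in> A // r"
      using eq xz by (auto intro: quotientI)
    moreover have "g x \<in> g ` (r `` {x})"
      using x by (rule imageI)
    ultimately have im: "g ` (r `` {x}) = r `` {g x}"
      using quotient_eqI[OF r _ quotientI[OF inA[OF xz(1)]]] equiv_class_self[OF r inA[OF xz(1)]] r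
      by (metis quotient_disj IntI empty_iff inA quotientI xz(1))
    have "(g x, g z) \<in> r \<longleftrightarrow> g z \<in> g ` (r `` {x})"
      by (simp add: im)
    also have "\<dots> \<longleftrightarrow> (x, z) \<in> r"
      using g xz rA by (auto simp: bij_betw_def inj_on_def)
    finally show "(g x, g z) \<in> r \<longleftrightarrow> (x, z) \<in> r" .
  qed
  show "(`) g ` (A // r) = A // r" if iff: "\<forall>x\<in>A. \<forall>z\<in>A. (g x, g z) \<in> r \<longleftrightarrow> (x, z) \<in> r"
  proof -
    have im: "g ` (r `` {x}) = r `` {g x}" if x: "x \<in> A" for x
    proof (intro equalityI subsetI)
      fix w assume "w \<in> g ` (r `` {x})"
      then show "w \<in> r `` {g x}" using iff x rA by auto
    next
      fix w assume w: "w \<in> r `` {g x}"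
      then obtain z where "z \<in> A" "w = g z"
        using g rA by (auto simp: bij_betw_def)
      then show "w \<in> g ` (r `` {x})" using iff x w by auto
    qed
    have "(`) g ` (A // r) = (\<lambda>x. r `` {g x}) ` A"
      by (auto simp: quotient_def im image_iff)
    also have "\<dots> = (\<lambda>x. r `` {x}) ` (g ` A)"
      by (simp add: image_image)
    also have "\<dots> = A // r"
      using g by (auto simp: quotient_def bij_betw_def)
    finally show ?thesis .
  qed
qed

lemma equiv_agree:
  "equiv (product_points s e)
    {(x, z) \<in> product_points s e \<times> product_points s e. \<forall>j\<in>{i<..s}. x j = z j}"
  by (rule equivI) (auto simp: refl_on_def sym_def trans_def)

lemma iterated_wreath_iff:
  "g \<in> iterated_wreath s e \<longleftrightarrow> g \<in> extensional (product_points s e) \<and> chain_map s e g"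
proof -
  let ?P = "product_points s e"
  have *: "(\<forall>i\<le>s. (`) g ` product_chain s e i = product_chain s e i) \<longleftrightarrow> chain_map s e g"
    if "bij_betw g ?P ?P"
    using bij_betw_imp_funcset[OF that] funcset_mem[OF bij_betw_imp_funcset[OF that]]
    unfolding product_chain_def image_quotient_eq_iff[OF equiv_agree that] chain_map_def agree_def
    by blast
  then show ?thesis
    using chain_map_bij by (auto simp: iterated_wreath_def chain_stabiliser_def Bij_def)
qed

lemma iterated_wreath_subset_Bij: "iterated_wreath s e \<subseteq> Bij (product_points s e)"
  by (auto simp: iterated_wreath_def chain_stabiliser_def)

lemma subgroup_iterated_wreath:
  "subgroup (iterated_wreath s e) (BijGroup (product_points s e))"
proof (rule group.subgroupI[OF group_BijGroup])
  show "iterated_wreath s e \<subseteq> carrier (BijGroup (product_points s e))"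
    using iterated_wreath_subset_Bij by (simp add: BijGroup_def)
  show "iterated_wreath s e \<noteq> {}"
    using chain_map_id[of s e] iterated_wreath_iff[of "\<lambda>x\<in>product_points s e. x" s e] by auto
next
  fix g assume g: "g \<in> iterated_wreath s e"
  then have "g \<in> Bij (product_points s e)"
    using iterated_wreath_subset_Bij by blast
  with g show "inv\<^bsub>BijGroup (product_points s e)\<^esub> g \<in> iterated_wreath s e"
    by (simp add: inv_BijGroup iterated_wreath_iff chain_map_inv_into)
next
  fix g h assume gh: "g \<in> iterated_wreath s e" "h \<in> iterated_wreath s e"
  then have "g \<in> Bij (product_points s e)" "h \<in> Bij (product_points s e)"
    using iterated_wreath_subset_Bij by auto
  then show "g \<otimes>\<^bsub>BijGroup (product_points s e)\<^esub> h \<in> iterated_wreath s e"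
    using gh by (simp add: BijGroup_def iterated_wreath_iff chain_map_compose compose_extensional)
qed

section \<open>Transitivity on flags\<close>

lemma chain_map_image_array_blocks:
  assumes g: "chain_map s e g" and X: "X \<in> array_blocks s e f"
  shows "g ` X \<in> array_blocks s e f"
proof -
  have XP: "X \<subseteq> product_points s e"
    using X by (rule array_blocks_subset)
  have "card {z \<in> g ` X. agree s i (g x) z} = (\<Prod>j=1..i. f j)" if "x \<in> X" "i \<le> s" for x i
  proof -
    have "{z \<in> g ` X. agree s i (g x) z} = g ` {z \<in> X. agree s i x z}"
      using g XP that unfolding chain_map_def by blast
    moreover have "inj_on g {z \<in> X. agree s i x z}"
      using chain_map_bij[OF g] XP by (auto simp: bij_betw_def intro: inj_on_subset)
    ultimately show ?thesis
      using X that by (simp add: card_image array_blocks_def)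
  qed
  moreover have "g ` X \<subseteq> product_points s e" "g ` X \<noteq> {}"
    using g X by (auto simp: chain_map_def array_blocks_def)
  ultimately show ?thesis
    by (auto simp: array_blocks_def)
qed

text \<open>Flag-transitivity of the symmetric group on subsets of a fixed size; it supplies the
  permutation of the slices.\<close>

lemma ex_bij_betw_mapping_subset:
  assumes "finite U" "A \<subseteq> U" "A' \<subseteq> U" "card A = card A'" "a \<in> A" "a' \<in> A'"
  shows "\<exists>p. bij_betw p U U \<and> p ` A = A' \<and> p a = a'"
proof -
  have fin: "finite A" "finite A'"
    using assms finite_subset by auto
  have ins: "{a} \<union> (A - {a}) = A" "{a'} \<union> (A' - {a'}) = A'" "A \<union> (U - A) = U" "A' \<union> (U - A') = U"
    using assms by auto
  obtain p where p: "bij_betw p (A - {a}) (A' - {a'})"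
    using assms fin by (metis card_Diff_singleton finite_Diff finite_same_card_bij)
  obtain q where q: "bij_betw q (U - A) (U - A')"
    using assms fin by (metis card_Diff_subset finite_Diff finite_same_card_bij)
  define t where "t = (\<lambda>x. if x \<in> A then (p(a := a')) x else q x)"
  have "bij_betw (p(a := a')) (A - {a}) (A' - {a'})"
    using p by (subst bij_betw_cong[of _ _ p]) auto
  then have "bij_betw (p(a := a')) ({a} \<union> (A - {a})) ({a'} \<union> (A' - {a'}))"
    by (intro bij_betw_combine) (auto simp: bij_betw_def)
  then have tA: "bij_betw t A A'"
    unfolding ins by (subst bij_betw_cong[of _ _ "p(a := a')"]) (auto simp: t_def)
  moreover have "bij_betw t (U - A) (U - A')"
    using q by (subst bij_betw_cong[of _ _ q]) (auto simp: t_def)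
  ultimately have "bij_betw t (A \<union> (U - A)) (A' \<union> (U - A'))"
    by (rule bij_betw_combine) auto
  moreover have "t ` A = A'" using tA by (simp add: bij_betw_def)
  moreover have "t a = a'" using assms by (simp add: t_def)
  ultimately show ?thesis
    unfolding ins by blast
qed

text \<open>The general shape of a wreath product element: act by \<open>g a\<close> inside slice
  \<open>a\<close>, then move that slice to position \<open>p a\<close>. The update with
  \<open>undefined\<close> drops the last coordinate.\<close>

lemma chain_map_Suc:
  assumes p: "bij_betw p {..<e (Suc s)} {..<e (Suc s)}"
    and g: "\<And>a. a < e (Suc s) \<Longrightarrow> chain_map s e (g a)"
  shows "chain_map (Suc s) e
    (\<lambda>x. (g (x (Suc s)) (x(Suc s := undefined)))(Suc s := p (x (Suc s))))" (is "chain_map _ _ ?h")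
proof -
  have h: "?h (x(Suc s := a)) = (g a x)(Suc s := p a)" if "x \<in> product_points s e" for x a
    using that by (simp add: upd_undefined_product_points)
  have pl: "p a < e (Suc s)" if "a < e (Suc s)" for a
    using p that by (auto simp: bij_betw_def)
  have gP: "g a x \<in> product_points s e" if "a < e (Suc s)" "x \<in> product_points s e" for a x
    using g[OF that(1)] that(2) by (auto simp: chain_map_def)
  have "?h \<in> product_points (Suc s) e \<rightarrow> product_points (Suc s) e"
  proof
    fix w assume "w \<in> product_points (Suc s) e"
    then obtain x a where "x \<in> product_points s e" "a < e (Suc s)" "w = x(Suc s := a)"
      by (rule product_points_SucE)
    then show "?h w \<in> product_points (Suc s) e"
      using h pl gP by (simp only: upd_mem_product_points)
  qed
  moreover have "agree (Suc s) i (?h w) (?h w') \<longleftrightarrow> agree (Suc s) i w w'"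
    if w: "w \<in> product_points (Suc s) e" "w' \<in> product_points (Suc s) e" and i: "i \<le> Suc s" for w w' i
  proof (cases "i = Suc s")
    case False
    then have i: "i \<le> s" using i by simp
    obtain x a where x: "x \<in> product_points s e" "a < e (Suc s)" "w = x(Suc s := a)"
      using w(1) by (rule product_points_SucE)
    obtain x' a' where x': "x' \<in> product_points s e" "a' < e (Suc s)" "w' = x'(Suc s := a')"
      using w(2) by (rule product_points_SucE)
    have "agree (Suc s) i (?h w) (?h w') \<longleftrightarrow> p a = p a' \<and> agree s i (g a x) (g a' x')"
      unfolding x(3) x'(3) h[OF x(1)] h[OF x'(1)] by (rule agree_Suc_upd[OF i])
    also have "\<dots> \<longleftrightarrow> a = a' \<and> agree s i x x'"
    proof (cases "a = a'")
      case True
      then show ?thesis using g[OF x(2)] x x' i by (simp add: chain_map_def)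
    next
      case False
      then show ?thesis using p x x' by (auto simp: bij_betw_def inj_on_def)
    qed
    also have "\<dots> \<longleftrightarrow> agree (Suc s) i w w'"
      unfolding x(3) x'(3) by (rule agree_Suc_upd[OF i, symmetric])
    finally show ?thesis .
  qed simp
  ultimately show ?thesis
    by (simp add: chain_map_def)
qed

text \<open>A permutation of the top coordinate matches the nonempty slices and sends the slice of
  \<open>x\<close> to that of \<open>x'\<close>; the induction hypothesis then matches the contents
  of each slice.\<close>

lemma chain_map_flag_transitive:
  assumes "\<And>j. j \<in> {1..s} \<Longrightarrow> f j > 0"
    "X \<in> array_blocks s e f" "X' \<in> array_blocks s e f" "x \<in> X" "x' \<in> X'"
  shows "\<exists>g. chain_map s e g \<and> g x = x' \<and> g ` X = X'"
  using assms
proof (induction s arbitrary: X X' x x')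
  case 0
  then show ?case
    using chain_map_id[of 0 e] by (auto simp: array_blocks_0)
next
  case (Suc s)
  note XP = array_blocks_subset[OF Suc.prems(2)] and X'P = array_blocks_subset[OF Suc.prems(3)]
  define A A' where "A = {a. a < e (Suc s) \<and> slice s e X a \<noteq> {}}"
    and "A' = {a. a < e (Suc s) \<and> slice s e X' a \<noteq> {}}"
  have AX: "slice s e X a \<in> array_blocks s e f" if "a \<in> A" for a
    using that Suc.prems array_blocks_Suc_iff[OF XP] by (auto simp: A_def)
  have AX': "slice s e X' a \<in> array_blocks s e f" if "a \<in> A'" for a
    using that Suc.prems array_blocks_Suc_iff[OF X'P] by (auto simp: A'_def)
  have card: "card A = card A'"
    using Suc.prems array_blocks_Suc_iff[OF XP] array_blocks_Suc_iff[OF X'P]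
    by (simp add: A_def A'_def)
  obtain z a where z: "z \<in> product_points s e" "a < e (Suc s)" "x = z(Suc s := a)"
    using Suc.prems XP product_points_SucE by blast
  obtain z' a' where z': "z' \<in> product_points s e" "a' < e (Suc s)" "x' = z'(Suc s := a')"
    using Suc.prems X'P product_points_SucE by blast
  have zX: "z \<in> slice s e X a" "z' \<in> slice s e X' a'"
    using Suc.prems(4,5) z z' unfolding slice_def by blast+
  then have "a \<in> A" "a' \<in> A'"
    using z z' by (auto simp: A_def A'_def)
  then obtain p where p: "bij_betw p {..<e (Suc s)} {..<e (Suc s)}" "p ` A = A'" "p a = a'"
    using ex_bij_betw_mapping_subset[of "{..<e (Suc s)}" A A' a a'] card
    by (auto simp: A_def A'_def)
  \<comment> \<open>In slice \<open>a\<close> the marked points must be \<open>z\<close> and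
    \<open>z'\<close>; in other nonempty slices any points do, and where the slice is empty the
    identity does.\<close>
  have "\<exists>g. chain_map s e g \<and> (c \<in> A \<longrightarrow> g ` slice s e X c = slice s e X' (p c)) \<and>
      (c = a \<longrightarrow> g z = z')" for c
  proof (cases "c \<in> A")
    case True
    then have pc: "p c \<in> A'" using p by auto
    obtain w where w: "w \<in> slice s e X c" "c = a \<Longrightarrow> w = z"
      using True zX by (cases "c = a") (auto simp: A_def)
    obtain w' where w': "w' \<in> slice s e X' (p c)" "c = a \<Longrightarrow> w' = z'"
      using pc zX p by (cases "c = a") (auto simp: A'_def)
    have "\<exists>g. chain_map s e g \<and> g w = w' \<and> g ` slice s e X c = slice s e X' (p c)"
      by (rule Suc.IH) (use Suc.prems AX[OF True] AX'[OF pc] w w' in auto)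
    then show ?thesis using w w' by auto
  next
    case False
    then show ?thesis using chain_map_id \<open>a \<in> A\<close> by blast
  qed
  then obtain g where g: "\<And>c. chain_map s e (g c)" "g a z = z'"
    "\<And>c. c \<in> A \<Longrightarrow> g c ` slice s e X c = slice s e X' (p c)"
    by metis
  define h where "h = (\<lambda>x. (g (x (Suc s)) (x(Suc s := undefined)))(Suc s := p (x (Suc s))))"
  have h: "h (x(Suc s := c)) = (g c x)(Suc s := p c)" if "x \<in> product_points s e" for x c
    using that by (simp add: upd_undefined_product_points h_def)
  have hmap: "chain_map (Suc s) e h"
    unfolding h_def using p(1) g(1) by (rule chain_map_Suc)
  \<comment> \<open>Inclusion suffices, since \<open>h\<close> is injective and all blocks have the
    same size.\<close>
  have "h ` X \<subseteq> X'"
  proof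
    fix u assume "u \<in> h ` X"
    then obtain w where w: "w \<in> X" "u = h w" by blast
    then obtain x c where x: "x \<in> product_points s e" "c < e (Suc s)" "w = x(Suc s := c)"
      using XP product_points_SucE by blast
    then have "x \<in> slice s e X c" using w by (simp add: slice_def)
    moreover from this have "c \<in> A" using x by (auto simp: A_def)
    ultimately have "g c x \<in> slice s e X' (p c)" using g(3) by blast
    then show "u \<in> X'" using w x h by (simp add: slice_def)
  qed
  moreover have "card (h ` X) = card X'"
  proof -
    have "inj_on h X"
      using chain_map_bij[OF hmap] XP by (auto simp: bij_betw_def intro: inj_on_subset)
    then show ?thesis
      using Suc.prems by (simp add: card_image card_array_blocks)
  qed
  ultimately have "h ` X = X'"
    using X'P finite_subset finite_product_points by (metis card_subset_eq)
  moreover have "h x = x'"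
    using z z' h[of z a] g p by simp
  ultimately show ?case
    using hmap by blast
qed

section \<open>The design\<close>

text \<open>Intersection sizes are invariant under the group, and flag-transitivity reaches every
  block from \<open>B\<close>.\<close>

lemma block_orbit_iterated_wreath:
  assumes "\<And>j. j \<in> {1..s} \<Longrightarrow> f j > 0" "B \<in> array_blocks s e f"
  shows "block_orbit (iterated_wreath s e) B = array_blocks s e f"
proof
  show "block_orbit (iterated_wreath s e) B \<subseteq> array_blocks s e f"
    using assms chain_map_image_array_blocks by (auto simp: block_orbit_def iterated_wreath_iff)
  show "array_blocks s e f \<subseteq> block_orbit (iterated_wreath s e) B"
  proof
    fix X assume X: "X \<in> array_blocks s e f"
    obtain x x' where "x \<in> B" "x' \<in> X"
      using X assms by (auto simp: array_blocks_def)
    then obtain g where g: "chain_map s e g" "g ` B = X"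
      using chain_map_flag_transitive[of s f B e X x x'] assms X by blast
    have "restrict g (product_points s e) ` B = g ` B"
      using array_blocks_subset[OF assms(2)] by (intro image_cong) auto
    moreover have "restrict g (product_points s e) \<in> iterated_wreath s e"
      using g(1) by (simp add: iterated_wreath_iff)
    ultimately show "X \<in> block_orbit (iterated_wreath s e) B"
      using g(2) unfolding block_orbit_def by blast
  qed
qed

lemma automorphism_group_iterated_wreath:
  "automorphism_group (iterated_wreath s e) (product_points s e) (array_blocks s e f)"
proof -
  have "(`) g ` array_blocks s e f = array_blocks s e f" if g: "g \<in> iterated_wreath s e" for g
  \<comment> \<open>There are finitely many blocks, so an injective map of blocks to blocks is
    onto.\<close>
  proof (rule endo_inj_surj)
    have g: "chain_map s e g"
      using that by (simp add: iterated_wreath_iff)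
    show "(`) g ` array_blocks s e f \<subseteq> array_blocks s e f"
      using chain_map_image_array_blocks[OF g] by blast
    show "inj_on ((`) g) (array_blocks s e f)"
    proof (rule inj_onI)
      fix X Y assume "X \<in> array_blocks s e f" "Y \<in> array_blocks s e f" "g ` X = g ` Y"
      then show "X = Y"
        using inj_on_image_eq_iff[OF bij_betw_imp_inj_on[OF chain_map_bij[OF g]]]
          array_blocks_subset[of _ s e f] by blast
    qed
  qed simp
  then have "iterated_wreath s e \<subseteq> automorphisms (product_points s e) (array_blocks s e f)"
    using iterated_wreath_subset_Bij[of s e] by (auto simp: automorphisms_def)
  then show ?thesis
    by (simp add: automorphism_group_def subgroup_iterated_wreath)
qed

lemma flag_transitive_iterated_wreath:
  assumes "\<And>j. j \<in> {1..s} \<Longrightarrow> f j > 0"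
  shows "flag_transitive (iterated_wreath s e) (product_points s e) (array_blocks s e f)"
proof -
  have "\<exists>g\<in>iterated_wreath s e. g x = z \<and> g ` X = Z"
    if X: "X \<in> array_blocks s e f" "x \<in> X" and Z: "Z \<in> array_blocks s e f" "z \<in> Z" for x X z Z
  proof -
    obtain g where g: "chain_map s e g" "g x = z" "g ` X = Z"
      using chain_map_flag_transitive[OF assms X(1) Z(1) X(2) Z(2)] by blast
    have XP: "X \<subseteq> product_points s e"
      using X(1) by (rule array_blocks_subset)
    then have "restrict g (product_points s e) ` X = g ` X"
      by (intro image_cong) auto
    then have "restrict g (product_points s e) ` X = Z" "restrict g (product_points s e) x = z"
      using g X(2) XP by auto
    moreover have "restrict g (product_points s e) \<in> iterated_wreath s e"
      using g by (simp add: iterated_wreath_iff)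
    ultimately show ?thesis by blast
  qed
  then show ?thesis
    using automorphism_group_iterated_wreath by (auto simp: flag_transitive_def flags_def)
qed

lemma partition_chain_product_chain:
  assumes "\<And>i. i \<in> {1..s} \<Longrightarrow> e i \<ge> 2"
  shows "partition_chain (product_points s e) s (product_chain s e)"
proof -
  define r where "r i = {(x, z) \<in> product_points s e \<times> product_points s e. agree s i x z}" for i
  have r: "equiv (product_points s e) (r i)" for i
    using equiv_agree[of s e i] by (simp add: r_def agree_def)
  have C: "product_chain s e i = product_points s e // r i" for i
    by (simp add: product_chain_def r_def agree_def)
  have "(\<lambda>j\<in>{1..s}. 0) \<in> product_points s e"
    using assms by (force simp: product_points_def)
  then obtain x0 where x0: "x0 \<in> product_points s e" "\<And>j. j \<in> {1..s} \<Longrightarrow> x0 j = 0"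
    by (metis restrict_apply')
  have "r 0 `` {x} = {x}" if "x \<in> product_points s e" for x
    using that by (auto simp: r_def agree_0)
  then have C0: "product_chain s e 0 = {{x} | x. x \<in> product_points s e}"
    unfolding C quotient_def by auto
  have "r s `` {x} = product_points s e" if "x \<in> product_points s e" for x
    using that by (auto simp: r_def)
  then have Cs: "product_chain s e s = {product_points s e}"
    unfolding C quotient_def using x0(1) by auto
  have "refines (product_points s e) (product_chain s e i) (product_chain s e (Suc i))" for i
  proof -
    have "r i \<subseteq> r (Suc i)"
      by (auto simp: r_def agree_def)
    then have "r i `` {x} \<subseteq> r (Suc i) `` {x}" for x
      by blast
    then have "\<exists>Y\<in>product_points s e // r (Suc i). X \<subseteq> Y" if "X \<in> product_points s e // r i" for X
      using that by (auto simp: quotient_def)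
    then show ?thesis
      using partition_on_quotient[OF r] by (simp add: refines_def C)
  qed
  moreover have "product_chain s e i \<noteq> product_chain s e (Suc i)" if i: "i < s" for i
  proof
    assume eq: "product_chain s e i = product_chain s e (Suc i)"
    \<comment> \<open>A point outside the level-\<open>i\<close> class of \<open>x0\<close> but
      inside its level-\<open>Suc i\<close> class; the value 1 is available because
      \<open>e (Suc i) \<ge> 2\<close>.\<close>
    define x1 where "x1 = x0(Suc i := 1)"
    have "1 < e (Suc i)"
      using assms[of "Suc i"] i by simp
    then have x1: "x1 \<in> product_points s e"
      using x0(1) i by (auto simp: product_points_def x1_def PiE_iff extensional_def)
    have "r i `` {x0} \<in> product_points s e // r (Suc i)"
      using eq x0(1) by (auto simp: C intro: quotientI)
    moreover have "x0 \<in> r i `` {x0}"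
      using x0(1) by (simp add: r_def)
    moreover have "(x0, x1) \<in> r (Suc i)"
      using x0(1) x1 by (auto simp: r_def agree_def x1_def)
    ultimately have "x1 \<in> r i `` {x0}"
      using in_quotient_imp_closed[OF r] by blast
    then have "x0 (Suc i) = x1 (Suc i)"
      using i by (auto simp: r_def agree_def)
    then show False
      using x0(2)[of "Suc i"] i by (simp add: x1_def)
  qed
  ultimately show ?thesis
    using C0 Cs by (simp add: partition_chain_def)
qed

text \<open>The ratios are integral because consecutive differences are
  \<open>m \<cdot> \<Prod>\<^sub>j\<^sub>\<le>\<^sub>i e\<^sub>j \<cdot> (e\<^sub>i\<^sub>+\<^sub>1 - 1) / d\<close> with \<open>m = (k - 1) d / (v - 1)\<close>.\<close>

lemma block_ratios:
  fixes y :: "nat \<Rightarrow> real" and e :: "nat \<Rightarrow> nat"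
  assumes v: "v = (\<Prod>i=1..s. e i)"
    and d: "d = Gcd ((\<lambda>i. e i - 1) ` {1..s})"
    and y: "y = (\<lambda>i. if i = 0 then 1
               else 1 + (real k - 1) / (real v - 1) * ((\<Prod>j=1..i. real (e j)) - 1))"
    and e: "\<And>i. i \<in> {1..s} \<Longrightarrow> e i \<ge> 2"
    and k: "1 < k" "k < v"
    and dvd: "(v - 1) dvd ((k - 1) * d)"
    and y_dvd: "\<And>i. i \<in> {1..s - 1} \<Longrightarrow>
           \<exists>m::int. y i = of_int m \<and>
             m dvd int ((e (i + 1) - 1) * (\<Prod>j=1..i. e j) div d)"
  obtains f :: "nat \<Rightarrow> nat" where
    "\<And>j. j \<in> {1..s} \<Longrightarrow> 2 \<le> f j \<and> f j \<le> e j"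
    "\<And>j. j \<in> {1..s} \<Longrightarrow> y j / y (j - 1) = real (f j)"
    "\<And>i. i \<le> s \<Longrightarrow> y i = real (\<Prod>j=1..i. f j)"
proof -
  define c where "c = (real k - 1) / (real v - 1)"
  define E where "E i = (\<Prod>j=1..i. e j)" for i
  have c: "0 < c" "c < 1"
    using k by (auto simp: c_def)
  have yE: "y i = 1 + c * (real (E i) - 1)" for i
    by (simp add: y c_def E_def)
  have Epos: "1 \<le> E i" if "i \<le> s" for i
  proof -
    have "0 < e j" if "j \<in> {1..i}" for j
      using e[of j] that \<open>i \<le> s\<close> by simp
    then have "0 < E i"
      unfolding E_def by (intro prod_pos) auto
    then show ?thesis by simp
  qed
  have ypos: "1 \<le> y i" if "i \<le> s" for i
    using Epos[OF that] c by (simp add: yE)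
  have ySuc: "y (Suc i) = y i + c * real (E i) * (real (e (Suc i)) - 1)" for i
    by (simp add: yE E_def algebra_simps)
  have step: "\<exists>n::nat. y (Suc i) = real n * y i \<and> 2 \<le> n \<and> n \<le> e (Suc i)" if i: "i < s" for i
  proof -
    have ei: "2 \<le> e (Suc i)"
      using e[of "Suc i"] i by simp
    have "d dvd e (Suc i) - 1"
      unfolding d using i by (intro Gcd_dvd) auto
    then obtain t where t: "e (Suc i) - 1 = d * t" ..
    then have d0: "d > 0"
      using ei by (cases d) auto
    obtain m where m: "(k - 1) * d = (v - 1) * m"
      using dvd ..
    have cd: "c * real d = real m"
    proof -
      have "(real k - 1) * real d = (real v - 1) * real m"
        using arg_cong[OF m, of real] k by (simp add: of_nat_diff)
      then show ?thesis
        using k by (simp add: c_def field_simps)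
    qed
    have div: "(e (Suc i) - 1) * E i div d = t * E i"
      unfolding t using d0 by (simp add: mult.assoc)
    \<comment> \<open>The divisibility assumption starts at \<open>i = 1\<close>; at
      \<open>i = 0\<close> the value \<open>y 0 = 1\<close> divides everything.\<close>
    obtain q :: int where q: "y i = of_int q" "q dvd int (t * E i)"
    proof (cases "i = 0")
      case True
      then show ?thesis using that[of 1] by (simp add: y)
    next
      case False
      then have "i \<in> {1..s - 1}"
        using i by auto
      then obtain q :: int where "y i = of_int q" "q dvd int ((e (i + 1) - 1) * (\<Prod>j=1..i. e j) div d)"
        using y_dvd by blast
      then show ?thesis
        using that[of q] div by (simp add: E_def)
    qed
    then obtain u where u: "int (t * E i) = q * u" by blast
    have "real (e (Suc i)) - 1 = real d * real t"
      using arg_cong[OF t, of real] ei by (simp add: of_nat_diff)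
    then have "y (Suc i) = y i + (c * real d) * (real t * real (E i))"
      by (simp add: ySuc mult_ac)
    also have "real t * real (E i) = of_int (q * u)"
      by (simp flip: u)
    also have "y i + (c * real d) * of_int (q * u) = of_int (1 + int m * u) * y i"
      by (simp add: cd q(1) algebra_simps)
    finally have n: "y (Suc i) = of_int (1 + int m * u) * y i" .
    \<comment> \<open>As \<open>u\<close> is the cofactor of \<open>y i\<close> in
      \<open>t * E i\<close>, the increment of \<open>y\<close> is \<open>m * u * y i\<close>, so
      the ratio is this integer. Its lower bound comes from the growth of \<open>y\<close>, that is
      from \<open>1 < k\<close>.\<close>
    define n where "n = 1 + int m * u"
    have "y i < y (Suc i)"
      using c ei Epos[of i] i by (simp add: ySuc)
    then have "1 * y i < of_int n * y i"
      by (simp only: n n_def mult_1)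
    then have n1: "1 < n"
      using ypos[of i] i by (simp add: mult_less_cancel_right)
    \<comment> \<open>This is exactly the slack \<open>e (Suc i) * y i - y (Suc i)\<close>; it is
      nonnegative because \<open>k < v\<close> gives \<open>c < 1\<close>.\<close>
    have "(1 - c) * (real (e (Suc i)) - 1) \<ge> 0"
      using c ei by simp
    moreover have "real (e (Suc i)) * y i - y (Suc i) = (1 - c) * (real (e (Suc i)) - 1)"
      by (simp add: yE E_def algebra_simps)
    ultimately have "of_int n * y i \<le> of_int (int (e (Suc i))) * y i"
      by (simp add: n n_def)
    then have "n \<le> int (e (Suc i))"
      using ypos[of i] i by (simp only: mult_le_cancel_right of_int_le_iff) auto
    then have "2 \<le> nat n \<and> nat n \<le> e (Suc i)"
      using n1 by linarith
    moreover have "y (Suc i) = real (nat n) * y i"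
      using n1 n by (simp add: n_def)
    ultimately show ?thesis by blast
  qed
  then obtain g where g: "\<And>i. i < s \<Longrightarrow> y (Suc i) = real (g i) * y i \<and> 2 \<le> g i \<and> g i \<le> e (Suc i)"
    by metis
  define f where "f j = g (j - 1)" for j
  show ?thesis
  proof (rule that[of f])
    fix j assume j: "j \<in> {1..s}"
    then obtain i where i: "j = Suc i" "i < s"
      by (cases j) auto
    then show "2 \<le> f j \<and> f j \<le> e j" "y j / y (j - 1) = real (f j)"
      using g[of i] ypos[of i] by (auto simp: f_def)
  next
    fix i assume "i \<le> s"
    then show "y i = real (\<Prod>j=1..i. f j)"
    proof (induction i)
      case 0
      then show ?case by (simp add: y)
    next
      case (Suc i)
      then show ?case using g[of i] by (simp add: f_def)
    qed
  qed
qed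

text \<open>The integrality conjunct certifies that the floors in \<open>b\<close> round nothing.
  That the quotient defining \<open>lam\<close> is a natural number is part of the claim.\<close>

theorem proposition4p3:
  fixes s k v d :: nat and e :: "nat \<Rightarrow> nat" and y :: "nat \<Rightarrow> real"
    and P B :: "(nat \<Rightarrow> nat) set"
    and G :: "((nat \<Rightarrow> nat) \<Rightarrow> (nat \<Rightarrow> nat)) set"
    and C :: "nat \<Rightarrow> (nat \<Rightarrow> nat) set set"
    and b :: nat
  assumes "v = (\<Prod>i=1..s. e i)"
    and "d = Gcd ((\<lambda>i. e i - 1) ` {1..s})"
    and "y = (\<lambda>i. if i = 0 then 1
               else 1 + (real k - 1) / (real v - 1) * ((\<Prod>j=1..i. real (e j)) - 1))"
    and "P = product_points s e"
    and "C = product_chain s e"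
    and "G = iterated_wreath s e"
    and "B = {\<delta> \<in> P. \<forall>i\<in>{1..s}. real (\<delta> i) \<le> y i / y (i - 1) - 1}"
    and "b = (\<Prod>j=1..s. (e j choose nat \<lfloor>y j / y (j - 1)\<rfloor>) ^ nat \<lfloor>real k / y j\<rfloor>)"
    and "s \<ge> 2"
    and "\<And>i. i \<in> {1..s} \<Longrightarrow> e i \<ge> 2"
    and "1 < k" and "k < v"
    and "(v - 1) dvd ((k - 1) * d)"
    and "\<And>i. i \<in> {1..s - 1} \<Longrightarrow>
           \<exists>m::int. y i = of_int m \<and>
             m dvd int ((e (i + 1) - 1) * (\<Prod>j=1..i. e j) div d)"
  shows "card B = k \<and>
    (\<forall>j\<in>{1..s}. y j / y (j - 1) \<in> \<nat> \<and> real k / y j \<in> \<nat>) \<and>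
    (\<exists>lam::nat.
       real lam = real b * real k * (real k - 1) / (real v * (real v - 1)) \<and>
       two_design P (block_orbit G B) v k lam \<and>
       flag_transitive G P (block_orbit G B) \<and>
       chain_imprimitive G s C P (block_orbit G B))"
proof -
  obtain f where f: "\<And>j. j \<in> {1..s} \<Longrightarrow> 2 \<le> f j \<and> f j \<le> e j"
    and ratio: "\<And>j. j \<in> {1..s} \<Longrightarrow> y j / y (j - 1) = real (f j)"
    and yf: "\<And>i. i \<le> s \<Longrightarrow> y i = real (\<Prod>j=1..i. f j)"
    using block_ratios[OF assms(1-3,10-14)] by metis
  have fpos: "0 < f j" and fle: "0 < f j \<and> f j \<le> e j" if "j \<in> {1..s}" for j
    using f[OF that] by auto
  define c where "c = (real k - 1) / (real v - 1)"
  have yc: "real (\<Prod>j=1..i. f j) = 1 + c * (real (\<Prod>j=1..i. e j) - 1)" if "i \<le> s" for i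
    using yf[OF that] by (simp add: assms(3) c_def split: if_splits)
  have k_prod: "k = (\<Prod>j=1..s. f j)"
  proof -
    have "real (\<Prod>j=1..s. f j) = 1 + c * (real v - 1)"
      using yc[of s] assms(1) by simp
    also have "\<dots> = real k"
      using assms(11,12) by (simp add: c_def)
    finally show ?thesis
      by linarith
  qed
  \<comment> \<open>Identifies the exponents in \<open>b\<close> with those of the recursive
    count.\<close>
  have quot: "real k / y j = real (\<Prod>i\<in>{j<..s}. f i)" if j: "j \<in> {1..s}" for j
  proof -
    have "{1..s} = {1..j} \<union> {j<..s}" "{1..j} \<inter> {j<..s} = {}"
      using j by auto
    then have "k = (\<Prod>i=1..j. f i) * (\<Prod>i\<in>{j<..s}. f i)"
      unfolding k_prod by (simp add: prod.union_disjoint)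
    moreover have "(\<Prod>i=1..j. f i) \<noteq> 0"
      using fpos j by (fastforce simp: prod_zero_iff)
    ultimately show ?thesis
      using yf[of j] j by simp
  qed
  have "B = {\<delta> \<in> product_points s e. \<forall>i\<in>{1..s}. \<delta> i < f i}"
  proof -
    have "real (\<delta> i) \<le> y i / y (i - 1) - 1 \<longleftrightarrow> \<delta> i < f i" if "i \<in> {1..s}" for \<delta> i
      unfolding ratio[OF that] by linarith
    then show ?thesis
      unfolding assms(4,7) by blast
  qed
  then have B: "B \<in> array_blocks s e f"
    using base_block_array_blocks[OF fle] by simp
  have orbit: "block_orbit G B = array_blocks s e f"
    unfolding assms(6) using fpos B by (rule block_orbit_iterated_wreath)
  have b: "b = card (array_blocks s e f)"
  proof -
    have "b = (\<Prod>j=1..s. (e j choose f j) ^ (\<Prod>i\<in>{j<..s}. f i))"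
      unfolding assms(8) by (intro prod.cong refl) (simp only: ratio quot floor_of_nat nat_int)
    then show ?thesis
      using card_array_blocks_eq_prod[where f = f, OF fpos] by simp
  qed
  have flag: "flag_transitive G P (array_blocks s e f)"
    unfolding assms(4,6) using fpos by (rule flag_transitive_iterated_wreath)
  have vk: "1 < v" "0 < k"
    using assms(11,12) by auto
  have bpos: "0 < b"
    using B by (auto simp: b card_gt_0_iff)
  \<comment> \<open>Flag-transitivity gives point-transitivity once every point lies in a block, and
    \<open>b * k > 0\<close> forces that.\<close>
  have ex_block: "\<exists>X\<in>array_blocks s e f. x \<in> X" if "x \<in> P" for x
  proof -
    have "card {X \<in> array_blocks s e f. x \<in> X} * v = b * k"
      using card_array_blocks_containing_point[where f = f, OF fle] that
      unfolding assms(1,4) b k_prod by blast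
    then have "card {X \<in> array_blocks s e f. x \<in> X} \<noteq> 0"
      using bpos vk by (metis mult_is_0 neq0_conv)
    then have "{X \<in> array_blocks s e f. x \<in> X} \<noteq> {}"
      by (metis card.empty)
    then show ?thesis by blast
  qed
  have chain: "chain_imprimitive G s C P (array_blocks s e f)"
    unfolding chain_imprimitive_def
  proof (intro conjI ballI allI impI)
    show "automorphism_group G P (array_blocks s e f)"
      using flag by (simp add: flag_transitive_def)
    show "partition_chain P s C"
      unfolding assms(4,5) using assms(10) by (rule partition_chain_product_chain)
    show "(`) g ` C i = C i" if "g \<in> G" "i \<le> s" for g i
      using that by (simp add: assms(5,6) iterated_wreath_def chain_stabiliser_def)
    show "\<exists>g\<in>G. g x = z" if "x \<in> P" "z \<in> P" for x z
    proof -
      obtain X Z where "X \<in> array_blocks s e f" "x \<in> X" "Z \<in> array_blocks s e f" "z \<in> Z"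
        using ex_block \<open>x \<in> P\<close> \<open>z \<in> P\<close> by blast
      then have "(x, X) \<in> flags P (array_blocks s e f)" "(z, Z) \<in> flags P (array_blocks s e f)"
        using \<open>x \<in> P\<close> \<open>z \<in> P\<close> by (auto simp: flags_def)
      moreover have "\<forall>p\<in>flags P (array_blocks s e f). \<forall>q\<in>flags P (array_blocks s e f).
          \<exists>g\<in>G. g (fst p) = fst q \<and> g ` snd p = snd q"
        using flag by (simp add: flag_transitive_def case_prod_unfold)
      ultimately show ?thesis
        by (metis fst_conv)
    qed
  qed
  define l where "l = real b * real k * (real k - 1) / (real v * (real v - 1))"
  have pair: "real (card {X \<in> array_blocks s e f. x \<in> X \<and> z \<in> X}) = l"
    if "x \<in> P" "z \<in> P" "x \<noteq> z" for x z
  proof -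
    have "real (card {X \<in> array_blocks s e f. x \<in> X \<and> z \<in> X}) * real v = real b * real k * c"
      using card_array_blocks_containing_pair[where f = f, OF f yc] that
      unfolding assms(1,4) b k_prod by blast
    then show ?thesis
      using vk by (simp add: l_def c_def field_simps)
  qed
  have cardP: "card P = v"
    by (simp add: assms(1,4) card_product_points)
  then have "\<not> card P \<le> Suc 0"
    using vk by simp
  \<comment> \<open>The quotient is integral because it counts the blocks through an actual pair of
    points, which exists as \<open>1 < v\<close>.\<close>
  then obtain x0 z0 where "x0 \<in> P" "z0 \<in> P" "x0 \<noteq> z0"
    using card_le_Suc0_iff_eq[of P] by (auto simp: assms(4))
  then obtain lam :: nat where lam: "real lam = l"
    using pair by blast
  have "two_design P (array_blocks s e f) v k lam"
    unfolding two_design_def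
  proof (intro conjI ballI impI)
    show "finite P" "card P = v" "array_blocks s e f \<noteq> {}"
      using cardP B by (auto simp: assms(4))
    show "X \<subseteq> P" "card X = k" if "X \<in> array_blocks s e f" for X
      using that array_blocks_subset card_array_blocks by (auto simp: assms(4) k_prod)
    show "card {X \<in> array_blocks s e f. x \<in> X \<and> z \<in> X} = lam"
      if "x \<in> P" "z \<in> P" "x \<noteq> z" for x z
      using pair[OF that] lam by simp
  qed
  moreover have "card B = k"
    using card_array_blocks[OF B] by (simp add: k_prod)
  moreover have "\<forall>j\<in>{1..s}. y j / y (j - 1) \<in> \<nat> \<and> real k / y j \<in> \<nat>"
    using ratio quot by (metis of_nat_in_Nats)
  ultimately show ?thesis
    using orbit flag chain lam unfolding l_def by auto
qed

end
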